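(* Let $H_1$ and $H_2$ be real Hilbert spaces and let $u : H_1 \to H_2$ be a bounded linear operator. Then $u$ is weakly$^*$ $1$-nuclear if and only if $u$ is a Hilbert-Schmidt operator.
   Context: For Banach spaces $E,F$ over $\mathbb{R}$, $x^*\in E^*$ and $y\in F$, write $x^*\otimes y$ for the operator $x\mapsto \langle x,x^*\rangle y$ from $E$ to $F$. A bounded operator $u:E\to F$ is called weakly$^*$ $1$-nuclear if there are a sequence $(x_n^* )_{n\ge1}$ in $E^*$ which is weakly$^*$ $1$-summable, i.e. $\sup_{x\in E,\|x\|\le 1}\sum_{n\ge1}|\langle x,x_n^*\rangle|<\infty$, and a bounded sequence $(y_n)_{n\ge1}\in\ell_\infty(F)$ such that $u=\sum_n x_n^*\otimes y_n$, i.e. $ux=\sum_{n}\langle x,x_n^*\rangle y_n$ for all $x\in E$. A bounded operator $u:H_1\to H_2$ between Hilbert spaces is Hilbert-Schmidt if there is an orthonormal basis $(e_i)_{i\in I}$ of $H_1$ with $\sum_{i\in I}\|ue_i\|^2<\infty$. *)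

theory Defs
  imports "HOL-Analysis.Analysis"
begin

class hilbert_space = real_inner + complete_space
begin
subclass banach ..
end

text \<open>The supremum is taken in \<open>[0,\<infinity>]\<close>, so divergent series contribute \<open>\<infinity>\<close>.\<close>

definition weakly_star_1_summable :: "(nat \<Rightarrow> 'a::banach \<Rightarrow>\<^sub>L real) \<Rightarrow> bool" where
  "weakly_star_1_summable \<xi> \<longleftrightarrow>
     (SUP x\<in>cball 0 1. \<Sum>n. ennreal \<bar>blinfun_apply (\<xi> n) x\<bar>) < \<infinity>"

definition weakly_star_1_nuclear :: "('a::banach \<Rightarrow>\<^sub>L 'b::banach) \<Rightarrow> bool" where
  "weakly_star_1_nuclear u \<longleftrightarrow>
     (\<exists>\<xi> y. weakly_star_1_summable \<xi> \<and> bounded (range y) \<and>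
        (\<forall>x. (\<lambda>n. blinfun_apply (\<xi> n) x *\<^sub>R y n) sums blinfun_apply u x))"

text \<open>Orthonormal bases are represented by their sets of members rather than as indexed
  families; an orthonormal family is injective, so nothing is lost.\<close>

definition orthonormal_basis :: "'a::hilbert_space set \<Rightarrow> bool" where
  "orthonormal_basis B \<longleftrightarrow>
     pairwise orthogonal B \<and> (\<forall>e\<in>B. norm e = 1) \<and> closure (span B) = UNIV"

definition hilbert_schmidt :: "('a::hilbert_space \<Rightarrow>\<^sub>L 'b::hilbert_space) \<Rightarrow> bool" where
  "hilbert_schmidt u \<longleftrightarrow>
     (\<exists>B. orthonormal_basis B \<and> (\<lambda>e. (norm (blinfun_apply u e))\<^sup>2) summable_on B)"

end

theory Submission
  imports Defs
begin

text \<open>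
  A Hilbert-Schmidt operator is a sum of rank one operators,
  \<open>u x = \<Sum>\<^sub>n \<langle>x, e\<^sub>n\<rangle> u e\<^sub>n\<close>.  Moving the length of \<open>u e\<^sub>n\<close> into the functional,
  the functionals \<open>\<parallel>u e\<^sub>n\<parallel> \<langle>\<cdot>, e\<^sub>n\<rangle>\<close> are weakly* 1-summable by the Cauchy-Schwarz and Bessel
  inequalities, and the remaining vectors have norm at most one.

  Conversely, let \<open>u = \<Sum>\<^sub>n \<xi>\<^sub>n \<otimes> y\<^sub>n\<close>.  Then \<open>u\<close> factors through \<open>\<ell>\<^sub>1\<close>, so its adjoint factors
  through \<open>\<ell>\<^sub>\<infinity>\<close>, and operators from \<open>\<ell>\<^sub>\<infinity>\<close> to a Hilbert space are 2-summing by the little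
  Grothendieck theorem; a 2-summing operator between Hilbert spaces is Hilbert-Schmidt.  The
  quantitative core is the finite inequality \<open>little_grothendieck\<close>: if every combination
  \<open>\<Sum>\<^sub>n t\<^sub>n x\<^sub>n\<close> with \<open>\<bar>t\<^sub>n\<bar> \<le> 1\<close> has norm at most \<open>C\<close>, then replacing the scalars \<open>t\<^sub>n\<close> by
  vectors \<open>b\<^sub>n\<close> in a Euclidean unit ball costs only a constant factor.  It is
  applied with \<open>x\<^sub>n\<close> representing \<open>\<xi>\<^sub>n\<close> on the span of finitely many basis vectors \<open>e\<close>,
  and with \<open>b\<^sub>n\<close> the coordinates of \<open>y\<^sub>n\<close>, divided by a bound for the sequence \<open>y\<close>, with respect
  to a finite orthonormal set whose span contains the vectors \<open>u e\<close>.  The resulting bound on \<open>\<Sum> \<parallel>u e\<parallel>\<^sup>2\<close> does not depend on the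
  finite set of basis vectors, whence summability over a whole orthonormal basis.
\<close>

section \<open>Orthonormal sets\<close>

definition orthonormal :: "'a::real_inner set \<Rightarrow> bool" where
  "orthonormal B \<longleftrightarrow> pairwise orthogonal B \<and> (\<forall>e\<in>B. norm e = 1)"

lemma orthonormal_inner:
  assumes "orthonormal B" "e \<in> B" "f \<in> B"
  shows "e \<bullet> f = (if e = f then 1 else 0)"
  using assms by (auto simp: orthonormal_def pairwise_def orthogonal_def dot_square_norm)

lemma orthonormal_mono: "orthonormal B \<Longrightarrow> A \<subseteq> B \<Longrightarrow> orthonormal A"
  unfolding orthonormal_def using pairwise_mono by blast

lemma orthonormal_insert_normalized:
  assumes B: "orthonormal B" and w: "w \<noteq> 0" "\<And>b. b \<in> B \<Longrightarrow> w \<bullet> b = 0"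
  shows "orthonormal (insert (w /\<^sub>R norm w) B)"
proof -
  have "orthogonal (w /\<^sub>R norm w) b" "orthogonal b (w /\<^sub>R norm w)" if "b \<in> B" for b
    using w(2)[OF that] by (simp_all add: orthogonal_def inner_commute[of b])
  moreover have "norm (w /\<^sub>R norm w) = 1" using w(1) by simp
  ultimately show ?thesis using B unfolding orthonormal_def pairwise_insert by blast
qed

lemma inner_orthonormal_sum:
  assumes "finite B" "orthonormal B" "b \<in> B"
  shows "(\<Sum>e\<in>B. c e *\<^sub>R e) \<bullet> b = c b"
proof -
  have "(\<Sum>e\<in>B. c e *\<^sub>R e) \<bullet> b = (\<Sum>e\<in>B. if e = b then c e else 0)"
    unfolding inner_sum_left
    by (rule sum.cong) (use orthonormal_inner[OF assms(2) _ assms(3)] in auto)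
  then show ?thesis using assms by simp
qed

lemma norm_orthonormal_sum:
  assumes "finite B" "orthonormal B"
  shows "(norm (\<Sum>e\<in>B. c e *\<^sub>R e))\<^sup>2 = (\<Sum>e\<in>B. (c e)\<^sup>2)"
proof -
  have "(norm (\<Sum>e\<in>B. c e *\<^sub>R e))\<^sup>2 = (\<Sum>e\<in>B. c e *\<^sub>R e) \<bullet> (\<Sum>f\<in>B. c f *\<^sub>R f)"
    by (simp add: dot_square_norm)
  also have "\<dots> = (\<Sum>f\<in>B. c f * ((\<Sum>e\<in>B. c e *\<^sub>R e) \<bullet> f))"
    by (simp add: inner_sum_right)
  also have "\<dots> = (\<Sum>e\<in>B. (c e)\<^sup>2)"
    by (rule sum.cong) (simp_all add: inner_orthonormal_sum[OF assms] power2_eq_square)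
  finally show ?thesis .
qed

lemma orthonormal_expansion:
  assumes B: "finite B" "orthonormal B" and v: "v \<in> span B"
  shows "(\<Sum>e\<in>B. (v \<bullet> e) *\<^sub>R e) = v"
proof -
  obtain c where c: "v = (\<Sum>e\<in>B. c e *\<^sub>R e)"
    using v B(1) by (auto simp: span_finite)
  show ?thesis unfolding c
    by (rule sum.cong) (simp_all add: inner_orthonormal_sum[OF B])
qed

lemma orthonormal_parseval:
  assumes "finite B" "orthonormal B" "v \<in> span B"
  shows "(norm v)\<^sup>2 = (\<Sum>e\<in>B. (v \<bullet> e)\<^sup>2)"
  using norm_orthonormal_sum[OF assms(1,2), of "\<lambda>e. v \<bullet> e"]
  unfolding orthonormal_expansion[OF assms] .

lemma orthonormal_bessel:
  assumes "finite B" "orthonormal B"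
  shows "(\<Sum>e\<in>B. (v \<bullet> e)\<^sup>2) \<le> (norm v)\<^sup>2"
proof -
  define p where "p = (\<Sum>e\<in>B. (v \<bullet> e) *\<^sub>R e)"
  have pp: "p \<bullet> p = (\<Sum>e\<in>B. (v \<bullet> e)\<^sup>2)"
    using norm_orthonormal_sum[OF assms, of "\<lambda>e. v \<bullet> e"]
    by (simp add: p_def dot_square_norm)
  have "v \<bullet> p = (\<Sum>e\<in>B. (v \<bullet> e)\<^sup>2)"
    by (simp add: p_def inner_sum_right power2_eq_square)
  moreover have "0 \<le> (v - p) \<bullet> (v - p)" by simp
  ultimately show ?thesis using pp
    by (simp add: inner_diff_left inner_diff_right inner_commute[of p v] power2_norm_eq_inner)
qed

text \<open>Gram-Schmidt orthogonalization; the vectors of \<open>S\<close> need not be independent, so a vector that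
  is already in the span is skipped.\<close>

lemma finite_gram_schmidt:
  assumes "finite S"
  shows "\<exists>G. finite G \<and> orthonormal G \<and> S \<subseteq> span G"
  using assms
proof (induction S)
  case empty
  show ?case by (intro exI[of _ "{}"]) (auto simp: orthonormal_def)
next
  case (insert v S)
  then obtain G where G: "finite G" "orthonormal G" "S \<subseteq> span G" by blast
  define p where "p = (\<Sum>e\<in>G. (v \<bullet> e) *\<^sub>R e)"
  have p: "p \<in> span G"
    unfolding p_def by (intro span_sum span_scale span_base)
  show ?case
  proof (cases "v = p")
    case True
    then show ?thesis using G p by blast
  next
    case False
    define g where "g = (v - p) /\<^sub>R norm (v - p)"
    have "(v - p) \<bullet> b = 0" if "b \<in> G" for b
      using inner_orthonormal_sum[OF G(1,2) that] by (simp add: p_def inner_diff_left)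
    then have on: "orthonormal (insert g G)"
      unfolding g_def using orthonormal_insert_normalized[OF G(2)] False by auto
    have sub: "span G \<subseteq> span (insert g G)" by (rule span_mono) auto
    have "v = p + norm (v - p) *\<^sub>R g" using False by (simp add: g_def)
    also have "\<dots> \<in> span (insert g G)"
      using p sub by (intro span_add span_scale) (auto intro: span_base)
    finally show ?thesis using on G sub by (intro exI[of _ "insert g G"]) auto
  qed
qed

text \<open>The witness is \<open>v - p\<close>, where \<open>p\<close> is the point of the closed span nearest to \<open>v\<close>.  A sequence
  in the span whose distances to \<open>v\<close> tend to the infimum is Cauchy by the parallelogram law, so
  completeness provides \<open>p\<close>; if \<open>v - p\<close> had a component along some \<open>b \<in> B\<close>, subtracting it would
  bring the point closer to \<open>v\<close>.\<close>

lemma exists_nonzero_orthogonal: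
  fixes v :: "'a::hilbert_space"
  assumes B: "orthonormal B" and v: "v \<notin> closure (span B)"
  shows "\<exists>w. w \<noteq> 0 \<and> (\<forall>b\<in>B. w \<bullet> b = 0)"
proof -
  define W where "W = span B"
  define d where "d = infdist v W"
  have W: "subspace W" "W \<noteq> {}"
    unfolding W_def using span_zero by auto
  have d0: "0 \<le> d" by (simp add: d_def infdist_nonneg)
  have dle: "d \<le> norm (v - w)" if "w \<in> W" for w
    using infdist_le[OF that, of v] by (simp add: d_def dist_norm)
  have "\<exists>w\<in>W. (norm (v - w))\<^sup>2 < d\<^sup>2 + inverse (real (Suc n))" for n
  proof -
    have "d < sqrt (d\<^sup>2 + inverse (real (Suc n)))"
      by (rule real_less_rsqrt) simp
    moreover have "bdd_below (dist v ` W)" by (rule bdd_belowI2[of _ 0]) simp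
    ultimately obtain w where "w \<in> W" "dist v w < sqrt (d\<^sup>2 + inverse (real (Suc n)))"
      unfolding d_def infdist_notempty[OF W(2)] using W(2) by (subst (asm) cINF_less_iff) auto
    moreover from this have "(norm (v - w))\<^sup>2 < (sqrt (d\<^sup>2 + inverse (real (Suc n))))\<^sup>2"
      by (intro power_strict_mono) (auto simp: dist_norm)
    ultimately show ?thesis by (auto simp: add_nonneg_nonneg)
  qed
  then obtain w where wW: "\<And>n. w n \<in> W"
    and wd: "\<And>n. (norm (v - w n))\<^sup>2 < d\<^sup>2 + inverse (real (Suc n))" by metis
  have close: "(norm (w m - w n))\<^sup>2 \<le> 2 * inverse (real (Suc m)) + 2 * inverse (real (Suc n))" for m n
  proof -
    have "(1/2) *\<^sub>R (w m + w n) \<in> W"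
      by (intro subspace_scale subspace_add W(1) wW)
    then have "d\<^sup>2 \<le> (norm (v - (1/2) *\<^sub>R (w m + w n)))\<^sup>2"
      using dle d0 power_mono by blast
    \<comment> \<open>the parallelogram law for \<open>v - w m\<close> and \<open>v - w n\<close>\<close>
    moreover have "(norm (w m - w n))\<^sup>2 = 2 * (norm (v - w m))\<^sup>2 + 2 * (norm (v - w n))\<^sup>2
        - 4 * (norm (v - (1/2) *\<^sub>R (w m + w n)))\<^sup>2"
      unfolding power2_norm_eq_inner
      by (simp add: inner_diff_left inner_diff_right inner_add_left inner_add_right
          inner_commute algebra_simps)
    ultimately show ?thesis using wd[of m] wd[of n] by linarith
  qed
  have "Cauchy w"
  proof (rule metric_CauchyI)
    fix e :: real assume "e > 0"
    then have "e\<^sup>2 / 4 > 0" by simp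
    then obtain M where M: "inverse (real (Suc M)) < e\<^sup>2 / 4" using reals_Archimedean by blast
    show "\<exists>M. \<forall>m\<ge>M. \<forall>n\<ge>M. dist (w m) (w n) < e"
    proof (intro exI allI impI)
      fix m n assume "m \<ge> M" "n \<ge> M"
      then have "inverse (real (Suc m)) \<le> inverse (real (Suc M))"
        "inverse (real (Suc n)) \<le> inverse (real (Suc M))" by auto
      then have "(norm (w m - w n))\<^sup>2 < e\<^sup>2" using close[of m n] M by linarith
      then show "dist (w m) (w n) < e"
        using \<open>e > 0\<close> by (simp add: dist_norm power2_less_imp_less)
    qed
  qed
  then obtain p where p: "w \<longlonglongrightarrow> p" using Cauchy_convergent convergent_def by blast
  have pW: "p \<in> closure W" using wW p closure_sequential by blast
  have "(\<lambda>n. (norm (v - w n))\<^sup>2) \<longlonglongrightarrow> (norm (v - p))\<^sup>2"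
    by (intro tendsto_intros p)
  moreover have "(\<lambda>n. d\<^sup>2 + inverse (real (Suc n))) \<longlonglongrightarrow> d\<^sup>2 + 0"
    by (intro tendsto_intros LIMSEQ_inverse_real_of_nat)
  ultimately have "(norm (v - p))\<^sup>2 \<le> d\<^sup>2 + 0"
    by (rule LIMSEQ_le) (use wd less_imp_le in blast)
  then have pd: "(norm (v - p))\<^sup>2 \<le> d\<^sup>2" by simp
  have "(v - p) \<bullet> b = 0" if "b \<in> B" for b
  proof -
    define c where "c = (v - p) \<bullet> b"
    have bW: "b \<in> W" unfolding W_def using that by (rule span_base)
    have bb: "b \<bullet> b = 1" using orthonormal_inner[OF B that that] by simp
    have "(\<lambda>n. norm (v - (w n + c *\<^sub>R b))) \<longlonglongrightarrow> norm (v - (p + c *\<^sub>R b))"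
      by (intro tendsto_intros p)
    moreover have "d \<le> norm (v - (w n + c *\<^sub>R b))" for n
      by (intro dle subspace_add subspace_scale W(1) bW wW)
    ultimately have "d \<le> norm (v - (p + c *\<^sub>R b))"
      by (intro LIMSEQ_le_const) auto
    then have "d\<^sup>2 \<le> (norm (v - (p + c *\<^sub>R b)))\<^sup>2" using d0 by (rule power_mono)
    also have "\<dots> = (norm ((v - p) - c *\<^sub>R b))\<^sup>2" by (simp add: algebra_simps)
    also have "\<dots> = (norm (v - p))\<^sup>2 - c\<^sup>2"
      unfolding power2_norm_eq_inner inner_diff_left[of "v - p"] inner_diff_right[of _ "v - p"]
      using bb by (simp add: c_def[symmetric] inner_commute[of b "v - p"] power2_eq_square)
    finally have "c\<^sup>2 \<le> 0" using pd by linarith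
    then show ?thesis by (simp add: c_def)
  qed
  moreover have "v - p \<noteq> 0" using v pW W_def by auto
  ultimately show ?thesis by blast
qed

text \<open>A maximal orthonormal set, given by Zorn's lemma, has dense span: otherwise a normalized vector
  orthogonal to it could be added.\<close>

lemma orthonormal_basis_exists: "\<exists>B :: 'a::hilbert_space set. orthonormal_basis B"
proof -
  have "\<exists>B\<in>{B :: 'a set. orthonormal B}. \<forall>X\<in>{B. orthonormal B}. B \<subseteq> X \<longrightarrow> X = B"
  proof (rule subset_Zorn')
    fix \<C> :: "'a set set" assume "subset.chain {B. orthonormal B} \<C>"
    then have on: "\<And>X. X \<in> \<C> \<Longrightarrow> orthonormal X"
      and ch: "\<And>X Y. X \<in> \<C> \<Longrightarrow> Y \<in> \<C> \<Longrightarrow> X \<subseteq> Y \<or> Y \<subseteq> X"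
      by (auto simp: subset_chain_def)
    have "orthogonal e f" if "e \<in> X" "X \<in> \<C>" "f \<in> Y" "Y \<in> \<C>" "e \<noteq> f" for e f X Y
      using ch[OF that(2,4)] on[OF that(2)] on[OF that(4)] that
      by (auto simp: orthonormal_def pairwise_def)
    then have "pairwise orthogonal (\<Union>\<C>)" by (auto simp: pairwise_def)
    then show "\<Union>\<C> \<in> {B. orthonormal B}" using on by (auto simp: orthonormal_def)
  qed
  then obtain B :: "'a set" where B: "orthonormal B"
    and max: "\<And>X. orthonormal X \<Longrightarrow> B \<subseteq> X \<Longrightarrow> X = B" by blast
  have "closure (span B) = UNIV"
  proof (rule ccontr)
    assume "closure (span B) \<noteq> UNIV"
    then obtain w where w: "w \<noteq> 0" "\<And>b. b \<in> B \<Longrightarrow> w \<bullet> b = 0"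
      using exists_nonzero_orthogonal[OF B] by blast
    then have "w /\<^sub>R norm w \<in> B"
      using max[OF orthonormal_insert_normalized[OF B w]] by blast
    then show False using w by fastforce
  qed
  then show ?thesis using B unfolding orthonormal_basis_def orthonormal_def by blast
qed

section \<open>Rademacher averages\<close>

text \<open>A set \<open>A \<subseteq> J\<close> encodes the choice of signs that is \<open>+1\<close> on \<open>A\<close> and \<open>-1\<close> on \<open>J - A\<close>; an
  expectation over independent signs is then a sum over
  \<open>Pow J\<close> divided by \<open>2 ^ card J\<close>.\<close>

definition rad :: "'j set \<Rightarrow> 'j \<Rightarrow> real" where
  "rad A j = (if j \<in> A then 1 else - 1)"

lemma sum_Pow_insert:
  fixes f :: "'j set \<Rightarrow> 'b::comm_monoid_add"
  assumes "finite J" "i \<notin> J"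
  shows "(\<Sum>A\<in>Pow (insert i J). f A) = (\<Sum>A\<in>Pow J. f A + f (insert i A))"
proof -
  have "(\<Sum>A\<in>Pow (insert i J). f A) = (\<Sum>A\<in>Pow J. f A) + (\<Sum>A\<in>insert i ` Pow J. f A)"
    unfolding Pow_insert using assms by (intro sum.union_disjoint) auto
  also have "(\<Sum>A\<in>insert i ` Pow J. f A) = (\<Sum>A\<in>Pow J. f (insert i A))"
  proof (subst sum.reindex)
    show "inj_on (insert i) (Pow J)" using assms(2) by (fastforce simp: inj_on_def)
  qed simp
  finally show ?thesis by (simp add: sum.distrib)
qed

lemma rad_sum_insert:
  fixes v :: "'j \<Rightarrow> 'a::real_vector"
  assumes "finite J" "i \<notin> J" "A \<in> Pow J"
  shows "(\<Sum>j\<in>insert i J. rad A j *\<^sub>R v j) = (\<Sum>j\<in>J. rad A j *\<^sub>R v j) - v i"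
    and "(\<Sum>j\<in>insert i J. rad (insert i A) j *\<^sub>R v j) = (\<Sum>j\<in>J. rad A j *\<^sub>R v j) + v i"
proof -
  have "i \<notin> A" using assms by auto
  then show "(\<Sum>j\<in>insert i J. rad A j *\<^sub>R v j) = (\<Sum>j\<in>J. rad A j *\<^sub>R v j) - v i"
    using assms by (simp add: rad_def)
  have "(\<Sum>j\<in>J. rad (insert i A) j *\<^sub>R v j) = (\<Sum>j\<in>J. rad A j *\<^sub>R v j)"
    by (rule sum.cong) (use assms in \<open>auto simp: rad_def\<close>)
  then show "(\<Sum>j\<in>insert i J. rad (insert i A) j *\<^sub>R v j) = (\<Sum>j\<in>J. rad A j *\<^sub>R v j) + v i"
    using assms by (simp add: rad_def)
qed

text \<open>Averaging over the last sign, the parallelogram law removes the cross term.\<close>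

lemma rad_second_moment:
  fixes v :: "'j \<Rightarrow> 'a::real_inner"
  assumes "finite J"
  shows "(\<Sum>A\<in>Pow J. (norm (\<Sum>j\<in>J. rad A j *\<^sub>R v j))\<^sup>2) = 2 ^ card J * (\<Sum>j\<in>J. (norm (v j))\<^sup>2)"
  using assms
proof (induction J)
  case (insert i J)
  define w where "w A = (\<Sum>j\<in>J. rad A j *\<^sub>R v j)" for A
  have "(\<Sum>A\<in>Pow (insert i J). (norm (\<Sum>j\<in>insert i J. rad A j *\<^sub>R v j))\<^sup>2)
      = (\<Sum>A\<in>Pow J. (norm (w A - v i))\<^sup>2 + (norm (w A + v i))\<^sup>2)"
    unfolding sum_Pow_insert[OF insert.hyps] w_def
    by (rule sum.cong) (simp_all only: rad_sum_insert[OF insert.hyps])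
  also have "\<dots> = (\<Sum>A\<in>Pow J. 2 * (norm (w A))\<^sup>2 + 2 * (norm (v i))\<^sup>2)"
    by (rule sum.cong) (simp_all add: power2_norm_eq_inner inner_diff_left inner_diff_right
        inner_add_left inner_add_right inner_commute)
  also have "\<dots> = 2 * (\<Sum>A\<in>Pow J. (norm (w A))\<^sup>2) + 2 ^ card J * (2 * (norm (v i))\<^sup>2)"
    using insert.hyps by (simp add: sum.distrib sum_distrib_left card_Pow)
  also have "\<dots> = 2 ^ card (insert i J) * (\<Sum>j\<in>insert i J. (norm (v j))\<^sup>2)"
    using insert by (simp add: w_def algebra_simps)
  finally show ?case .
qed simp

text \<open>The fourth power case of Khinchine's inequality.  With \<open>s\<close> the previous sum of squares, one more
  term \<open>v i\<close> raises the fourth moment by \<open>6 (v i)\<^sup>2 s + (v i)\<^sup>4\<close>, which is at most the increase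
  \<open>6 (v i)\<^sup>2 s + 3 (v i)\<^sup>4\<close> of the right-hand side.\<close>

lemma rad_fourth_moment:
  fixes v :: "'j \<Rightarrow> real"
  assumes "finite J"
  shows "(\<Sum>A\<in>Pow J. (\<Sum>j\<in>J. rad A j * v j) ^ 4) \<le> 2 ^ card J * (3 * (\<Sum>j\<in>J. (v j)\<^sup>2)\<^sup>2)"
  using assms
proof (induction J)
  case (insert i J)
  define w where "w A = (\<Sum>j\<in>J. rad A j * v j)" for A
  define s where "s = (\<Sum>j\<in>J. (v j)\<^sup>2)"
  have w2: "(\<Sum>A\<in>Pow J. (w A)\<^sup>2) = 2 ^ card J * s"
    using rad_second_moment[OF insert.hyps(1), of v] by (simp add: w_def s_def)
  have "(\<Sum>A\<in>Pow (insert i J). (\<Sum>j\<in>insert i J. rad A j * v j) ^ 4)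
      = (\<Sum>A\<in>Pow J. (w A - v i) ^ 4 + (w A + v i) ^ 4)"
    unfolding sum_Pow_insert[OF insert.hyps] w_def
    by (rule sum.cong) (simp_all only: rad_sum_insert[OF insert.hyps, where v = v, unfolded real_scaleR_def])
  also have "\<dots> = (\<Sum>A\<in>Pow J. 2 * (w A) ^ 4 + 12 * (v i)\<^sup>2 * (w A)\<^sup>2 + 2 * (v i) ^ 4)"
    by (rule sum.cong) (simp_all add: power4_eq_xxxx power2_eq_square algebra_simps)
  also have "\<dots> = 2 * (\<Sum>A\<in>Pow J. (w A) ^ 4) + 12 * (v i)\<^sup>2 * (\<Sum>A\<in>Pow J. (w A)\<^sup>2)
      + 2 ^ card J * (2 * (v i) ^ 4)"
    using insert.hyps by (simp add: sum.distrib sum_distrib_left card_Pow)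
  also have "\<dots> \<le> 2 * (2 ^ card J * (3 * s\<^sup>2)) + 12 * (v i)\<^sup>2 * (2 ^ card J * s)
      + 2 ^ card J * (6 * (v i) ^ 4)"
    using insert.IH unfolding w2 by (intro add_mono mult_left_mono) (auto simp: w_def s_def)
  also have "\<dots> = 2 ^ card (insert i J) * (3 * (\<Sum>j\<in>insert i J. (v j)\<^sup>2)\<^sup>2)"
  proof -
    have "(\<Sum>j\<in>insert i J. (v j)\<^sup>2) = (v i)\<^sup>2 + s" using insert.hyps by (simp add: s_def)
    then show ?thesis
      using insert.hyps by (simp add: power4_eq_xxxx power2_eq_square algebra_simps)
  qed
  finally show ?case .
qed simp

section \<open>The little Grothendieck inequality\<close>

text \<open>Let \<open>S\<close> be the supremum of the left-hand side over all admissible families \<open>b\<close>, in any finite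
  dimension.  Replace the coordinate vector \<open>b\<^sub>n\<close> by the random variable \<open>X\<^sub>n = \<Sum>\<^sub>j \<plusminus> b\<^sub>n\<^sub>j\<close>, which
  leaves the quantity unchanged by the second moment identity, and truncate:
  \<open>X\<^sub>n = Y\<^sub>n + Z\<^sub>n\<close> with \<open>Y\<^sub>n\<^sup>2 \<le> 12\<close>.  The bounded part is controlled pointwise by the hypothesis
  on scalar combinations and contributes at most \<open>12 C\<^sup>2\<close>.  The tail has small variance by
  the fourth moment bound, \<open>E Z\<^sub>n\<^sup>2 \<le> E X\<^sub>n\<^sup>4 / 12 \<le> 1/4\<close>; its values over the sample
  space form, up to scaling, another admissible family, so it contributes at most \<open>S / 4\<close>.
  Hence \<open>S \<le> 2 (12 C\<^sup>2 + S / 4)\<close>, and this bounds \<open>S\<close> because \<open>S\<close> is finite.\<close>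

lemma little_grothendieck:
  fixes x :: "'n \<Rightarrow> 'a::real_inner" and b :: "'n \<Rightarrow> 'j \<Rightarrow> real"
  assumes C: "\<And>t. (\<And>n. \<bar>t n\<bar> \<le> 1) \<Longrightarrow> norm (\<Sum>n\<in>N. t n *\<^sub>R x n) \<le> C"
    and G: "finite G"
    and b: "\<And>n. n \<in> N \<Longrightarrow> (\<Sum>j\<in>G. (b n j)\<^sup>2) \<le> 1"
  shows "(\<Sum>j\<in>G. (norm (\<Sum>n\<in>N. b n j *\<^sub>R x n))\<^sup>2) \<le> 48 * C\<^sup>2"
proof -
  define Q where "Q = {\<Sum>j<k. (norm (\<Sum>n\<in>N. c n j *\<^sub>R x n))\<^sup>2 | k c.
      \<forall>n\<in>N. (\<Sum>j<(k::nat). (c n j)\<^sup>2) \<le> (1::real)}"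
  define S where "S = Sup Q"
  \<comment> \<open>The crude Cauchy-Schwarz bound, which depends on \<open>N\<close>, only serves to make \<open>S\<close> finite.\<close>
  have bdd: "bdd_above Q"
  proof (rule bdd_aboveI)
    fix q assume "q \<in> Q"
    then obtain k :: nat and c :: "'n \<Rightarrow> nat \<Rightarrow> real" where q: "q = (\<Sum>j<k. (norm (\<Sum>n\<in>N. c n j *\<^sub>R x n))\<^sup>2)"
      and c: "\<And>n. n \<in> N \<Longrightarrow> (\<Sum>j<k. (c n j)\<^sup>2) \<le> 1" by (auto simp: Q_def)
    have "(norm (\<Sum>n\<in>N. c n j *\<^sub>R x n))\<^sup>2 \<le> (\<Sum>n\<in>N. (c n j)\<^sup>2) * (\<Sum>n\<in>N. (norm (x n))\<^sup>2)" for j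
    proof -
      have "norm (\<Sum>n\<in>N. c n j *\<^sub>R x n) \<le> (\<Sum>n\<in>N. \<bar>c n j\<bar> * norm (x n))"
        by (rule order_trans[OF norm_sum]) simp
      then have "(norm (\<Sum>n\<in>N. c n j *\<^sub>R x n))\<^sup>2 \<le> (\<Sum>n\<in>N. \<bar>c n j\<bar> * norm (x n))\<^sup>2"
        by (intro power_mono) auto
      also have "\<dots> \<le> (\<Sum>n\<in>N. \<bar>c n j\<bar>\<^sup>2) * (\<Sum>n\<in>N. (norm (x n))\<^sup>2)"
        by (rule Cauchy_Schwarz_ineq_sum)
      finally show ?thesis by simp
    qed
    then have "q \<le> (\<Sum>j<k. (\<Sum>n\<in>N. (c n j)\<^sup>2) * (\<Sum>n\<in>N. (norm (x n))\<^sup>2))"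
      unfolding q by (intro sum_mono)
    also have "\<dots> = (\<Sum>n\<in>N. \<Sum>j<k. (c n j)\<^sup>2) * (\<Sum>n\<in>N. (norm (x n))\<^sup>2)"
      unfolding sum_distrib_right[symmetric] by (subst sum.swap) simp
    also have "\<dots> \<le> (\<Sum>n\<in>N. 1) * (\<Sum>n\<in>N. (norm (x n))\<^sup>2)"
      by (intro mult_right_mono sum_mono c sum_nonneg) auto
    finally show "q \<le> (\<Sum>n\<in>N. 1) * (\<Sum>n\<in>N. (norm (x n))\<^sup>2)" .
  qed
  \<comment> \<open>The supremum runs over index sets \<open>{..<k}\<close> so that one type suffices; a bijection transfers it
    to every finite index set, in particular to the sample space \<open>Pow {..<k}\<close> below.\<close>
  have le_S: "(\<Sum>j\<in>J. (norm (\<Sum>n\<in>N. c n j *\<^sub>R x n))\<^sup>2) \<le> S"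
    if J: "finite J" and c: "\<And>n. n \<in> N \<Longrightarrow> (\<Sum>j\<in>J. (c n j)\<^sup>2) \<le> 1"
    for J :: "'i set" and c :: "'n \<Rightarrow> 'i \<Rightarrow> real"
  proof -
    obtain h where h: "bij_betw h {..<card J} J"
      using ex_bij_betw_nat_finite[OF J] by (auto simp: atLeast0LessThan)
    have "(\<Sum>j<card J. (c n (h j))\<^sup>2) = (\<Sum>j\<in>J. (c n j)\<^sup>2)" for n
      by (rule sum.reindex_bij_betw[OF h])
    then have "(\<Sum>j<card J. (norm (\<Sum>n\<in>N. c n (h j) *\<^sub>R x n))\<^sup>2) \<in> Q"
      unfolding Q_def using c
      by (intro CollectI exI[of _ "card J"] exI[of _ "\<lambda>n j. c n (h j)"]) auto
    then have "(\<Sum>j<card J. (norm (\<Sum>n\<in>N. c n (h j) *\<^sub>R x n))\<^sup>2) \<le> S"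
      unfolding S_def by (rule cSup_upper[OF _ bdd])
    also have "(\<Sum>j<card J. (norm (\<Sum>n\<in>N. c n (h j) *\<^sub>R x n))\<^sup>2)
        = (\<Sum>j\<in>J. (norm (\<Sum>n\<in>N. c n j *\<^sub>R x n))\<^sup>2)"
      by (rule sum.reindex_bij_betw[OF h])
    finally show ?thesis .
  qed
  have "S \<le> 24 * C\<^sup>2 + S / 2"
    unfolding S_def
  proof (rule cSup_least)
    have "(\<Sum>j<0. (norm (\<Sum>n\<in>N. 0 *\<^sub>R x n))\<^sup>2) \<in> Q"
      unfolding Q_def by (intro CollectI exI[of _ 0] exI[of _ "\<lambda>_ _. 0"]) auto
    then show "Q \<noteq> {}" by blast
  next
    fix q assume "q \<in> Q"
    then obtain k :: nat and c :: "'n \<Rightarrow> nat \<Rightarrow> real" where q: "q = (\<Sum>j<k. (norm (\<Sum>n\<in>N. c n j *\<^sub>R x n))\<^sup>2)"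
      and c: "\<And>n. n \<in> N \<Longrightarrow> (\<Sum>j<k. (c n j)\<^sup>2) \<le> 1" by (auto simp: Q_def)
    define X where "X n A = (\<Sum>j<k. rad A j * c n j)" for n A
    define Y where "Y n A = (if (X n A)\<^sup>2 \<le> 12 then X n A else 0)" for n A
    define Z where "Z n A = X n A - Y n A" for n A
    define P where "P = Pow {..<k}"
    have P: "finite P" "card P = 2 ^ k" by (auto simp: P_def card_Pow)
    have "2 ^ k * q = (\<Sum>A\<in>P. (norm (\<Sum>j<k. rad A j *\<^sub>R (\<Sum>n\<in>N. c n j *\<^sub>R x n)))\<^sup>2)"
      unfolding q P_def by (subst rad_second_moment) auto
    also have "\<dots> = (\<Sum>A\<in>P. (norm (\<Sum>n\<in>N. X n A *\<^sub>R x n))\<^sup>2)"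
      unfolding X_def scaleR_sum_left scaleR_sum_right by (subst sum.swap) simp
    also have "\<dots> \<le> (\<Sum>A\<in>P. 2 * (norm (\<Sum>n\<in>N. Y n A *\<^sub>R x n))\<^sup>2
        + 2 * (norm (\<Sum>n\<in>N. Z n A *\<^sub>R x n))\<^sup>2)"
    proof (rule sum_mono)
      fix A
      define y z where "y = (\<Sum>n\<in>N. Y n A *\<^sub>R x n)" and "z = (\<Sum>n\<in>N. Z n A *\<^sub>R x n)"
      have split: "(\<Sum>n\<in>N. X n A *\<^sub>R x n) = y + z"
        unfolding y_def z_def Z_def by (simp add: sum.distrib[symmetric] scaleR_add_left[symmetric])
      have "(norm (y + z))\<^sup>2 + (norm (y - z))\<^sup>2 = 2 * (norm y)\<^sup>2 + 2 * (norm z)\<^sup>2"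
        by (simp add: power2_norm_eq_inner inner_diff_left inner_diff_right
          inner_add_left inner_add_right inner_commute)
      moreover have "0 \<le> (norm (y - z))\<^sup>2" by (rule zero_le_power2)
      ultimately show "(norm (\<Sum>n\<in>N. X n A *\<^sub>R x n))\<^sup>2 \<le> 2 * (norm y)\<^sup>2 + 2 * (norm z)\<^sup>2"
        unfolding split by linarith
    qed
    also have "\<dots> = 2 * (\<Sum>A\<in>P. (norm (\<Sum>n\<in>N. Y n A *\<^sub>R x n))\<^sup>2)
        + 2 * (\<Sum>A\<in>P. (norm (\<Sum>n\<in>N. Z n A *\<^sub>R x n))\<^sup>2)"
      by (simp add: sum.distrib sum_distrib_left)
    also have "\<dots> \<le> 2 * (2 ^ k * (12 * C\<^sup>2)) + 2 * (2 ^ k * (S / 4))"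
    proof (intro add_mono mult_left_mono)
      have "(norm (\<Sum>n\<in>N. Y n A *\<^sub>R x n))\<^sup>2 \<le> 12 * C\<^sup>2" for A
      proof -
        have Y: "\<bar>Y n A / sqrt 12\<bar> \<le> 1" for n
        proof -
          have "\<bar>Y n A\<bar> \<le> sqrt 12"
            by (rule real_le_rsqrt) (auto simp: Y_def)
          then show ?thesis by (simp add: abs_divide)
        qed
        have "(\<Sum>n\<in>N. Y n A *\<^sub>R x n) = sqrt 12 *\<^sub>R (\<Sum>n\<in>N. (Y n A / sqrt 12) *\<^sub>R x n)"
          by (simp add: scaleR_sum_right)
        then have "(norm (\<Sum>n\<in>N. Y n A *\<^sub>R x n))\<^sup>2
            = 12 * (norm (\<Sum>n\<in>N. (Y n A / sqrt 12) *\<^sub>R x n))\<^sup>2"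
          by (simp add: power_mult_distrib)
        also have "\<dots> \<le> 12 * C\<^sup>2"
          using C[OF Y] by (intro mult_left_mono power_mono) auto
        finally show ?thesis .
      qed
      then have "(\<Sum>A\<in>P. (norm (\<Sum>n\<in>N. Y n A *\<^sub>R x n))\<^sup>2) \<le> (\<Sum>A\<in>P. 12 * C\<^sup>2)"
        by (intro sum_mono)
      then show "(\<Sum>A\<in>P. (norm (\<Sum>n\<in>N. Y n A *\<^sub>R x n))\<^sup>2) \<le> 2 ^ k * (12 * C\<^sup>2)"
        by (simp add: P)
    next
      \<comment> \<open>\<open>1 / sqrt (2 ^ k)\<close> turns sums over the sample space into averages, and the factor \<open>2\<close> uses up
        the slack in \<open>E Z\<^sub>n\<^sup>2 \<le> 1/4\<close>.\<close>
      define r where "r = 2 / sqrt (2 ^ k)"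
      have r: "r\<^sup>2 = 4 / 2 ^ k" by (simp add: r_def power_divide)
      have "(\<Sum>A\<in>P. (norm (\<Sum>n\<in>N. (r * Z n A) *\<^sub>R x n))\<^sup>2) \<le> S"
      proof (rule le_S[OF P(1)])
        fix n assume n: "n \<in> N"
        have Z: "(Z n A)\<^sup>2 \<le> (X n A) ^ 4 / 12" for A
        proof (cases "(X n A)\<^sup>2 \<le> 12")
          case True
          then show ?thesis by (simp add: Z_def Y_def)
        next
          case False
          then have "12 * (X n A)\<^sup>2 \<le> (X n A)\<^sup>2 * (X n A)\<^sup>2" by (intro mult_right_mono) auto
          then show ?thesis using False by (simp add: Z_def Y_def power4_eq_xxxx power2_eq_square)
        qed
        have "(\<Sum>A\<in>P. (r * Z n A)\<^sup>2) = 4 / 2 ^ k * (\<Sum>A\<in>P. (Z n A)\<^sup>2)"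
          by (simp add: power_mult_distrib r sum_distrib_left)
        also have "\<dots> \<le> 4 / 2 ^ k * ((\<Sum>A\<in>P. (X n A) ^ 4) / 12)"
          unfolding sum_divide_distrib by (intro mult_left_mono sum_mono Z) auto
        also have "\<dots> \<le> 4 / 2 ^ k * (2 ^ k * (3 * (\<Sum>j<k. (c n j)\<^sup>2)\<^sup>2) / 12)"
          using rad_fourth_moment[of "{..<k}" "c n"]
          by (intro mult_left_mono divide_right_mono) (auto simp: P_def X_def)
        also have "\<dots> = (\<Sum>j<k. (c n j)\<^sup>2)\<^sup>2" by simp
        also have "\<dots> \<le> 1" using c[OF n] by (intro power_le_one sum_nonneg) auto
        finally show "(\<Sum>A\<in>P. (r * Z n A)\<^sup>2) \<le> 1" .
      qed
      also have "(\<Sum>A\<in>P. (norm (\<Sum>n\<in>N. (r * Z n A) *\<^sub>R x n))\<^sup>2)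
          = 4 / 2 ^ k * (\<Sum>A\<in>P. (norm (\<Sum>n\<in>N. Z n A *\<^sub>R x n))\<^sup>2)"
        unfolding scaleR_scaleR[symmetric] scaleR_sum_right[symmetric] norm_scaleR power_mult_distrib
        by (simp add: r sum_distrib_left)
      finally show "(\<Sum>A\<in>P. (norm (\<Sum>n\<in>N. Z n A *\<^sub>R x n))\<^sup>2) \<le> 2 ^ k * (S / 4)"
        by (simp add: field_simps)
    qed simp_all
    also have "\<dots> = 2 ^ k * (24 * C\<^sup>2 + S / 2)" by (simp add: algebra_simps)
    finally show "q \<le> 24 * C\<^sup>2 + Sup Q / 2" by (simp add: S_def)
  qed
  then have "S \<le> 48 * C\<^sup>2" by simp
  then show ?thesis using le_S[OF G, of b] b by fastforce
qed

section \<open>The two implications\<close>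

text \<open>By homogeneity the extended supremum is a finite bound on real partial sums, the form in which
  both implications use it.\<close>

lemma weakly_star_1_summable_iff:
  "weakly_star_1_summable \<xi> \<longleftrightarrow>
     (\<exists>C\<ge>0. \<forall>x N. (\<Sum>n<N. \<bar>blinfun_apply (\<xi> n) x\<bar>) \<le> C * norm x)"
proof
  assume "weakly_star_1_summable \<xi>"
  then have "(SUP x\<in>cball 0 1. \<Sum>n. ennreal \<bar>blinfun_apply (\<xi> n) x\<bar>) < top"
    by (simp add: weakly_star_1_summable_def)
  then obtain C where C: "C \<ge> 0"
    "(SUP x\<in>cball 0 1. \<Sum>n. ennreal \<bar>blinfun_apply (\<xi> n) x\<bar>) = ennreal C"
    unfolding less_top_ennreal by blast
  have unit: "(\<Sum>n<N. \<bar>blinfun_apply (\<xi> n) x\<bar>) \<le> C" if "norm x \<le> 1" for x N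
  proof -
    have "ennreal (\<Sum>n<N. \<bar>blinfun_apply (\<xi> n) x\<bar>) = (\<Sum>n<N. ennreal \<bar>blinfun_apply (\<xi> n) x\<bar>)"
      by simp
    also have "\<dots> \<le> (\<Sum>n. ennreal \<bar>blinfun_apply (\<xi> n) x\<bar>)"
      by (rule sum_le_suminf) auto
    also have "\<dots> \<le> ennreal C"
      unfolding C(2)[symmetric] by (rule SUP_upper) (use that in simp)
    finally show ?thesis using C(1) by simp
  qed
  have "(\<Sum>n<N. \<bar>blinfun_apply (\<xi> n) x\<bar>) \<le> C * norm x" for x N
  proof (cases "x = 0")
    case False
    have "(\<Sum>n<N. \<bar>blinfun_apply (\<xi> n) x\<bar>)
        = (\<Sum>n<N. \<bar>blinfun_apply (\<xi> n) (x /\<^sub>R norm x)\<bar>) * norm x"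
      unfolding sum_distrib_right
      by (rule sum.cong) (use False in \<open>simp_all add: blinfun.scaleR_right abs_mult\<close>)
    also have "\<dots> \<le> C * norm x"
      using False by (intro mult_right_mono unit) auto
    finally show ?thesis .
  qed simp
  then show "\<exists>C\<ge>0. \<forall>x N. (\<Sum>n<N. \<bar>blinfun_apply (\<xi> n) x\<bar>) \<le> C * norm x"
    using C(1) by blast
next
  assume "\<exists>C\<ge>0. \<forall>x N. (\<Sum>n<N. \<bar>blinfun_apply (\<xi> n) x\<bar>) \<le> C * norm x"
  then obtain C where C: "C \<ge> 0" "\<And>x N. (\<Sum>n<N. \<bar>blinfun_apply (\<xi> n) x\<bar>) \<le> C * norm x" by blast
  have "(SUP x\<in>cball 0 1. \<Sum>n. ennreal \<bar>blinfun_apply (\<xi> n) x\<bar>) \<le> ennreal C"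
  proof (intro SUP_least suminf_le_const summableI)
    fix x :: 'a and N assume "x \<in> cball 0 1"
    then have "C * norm x \<le> C" using C(1) by (simp add: mult_left_le)
    then have "(\<Sum>n<N. \<bar>blinfun_apply (\<xi> n) x\<bar>) \<le> C" using C(2)[where x=x and N=N] by linarith
    then show "(\<Sum>n<N. ennreal \<bar>blinfun_apply (\<xi> n) x\<bar>) \<le> ennreal C"
      by (simp add: ennreal_leI)
  qed
  then show "weakly_star_1_summable \<xi>"
    by (simp add: weakly_star_1_summable_def le_less_trans)
qed

text \<open>All estimates take place on the span of a finite part \<open>F\<close> of an orthonormal basis, where the
  functional \<open>\<xi> n\<close> is the inner product with the explicit vector
  \<open>x n = \<Sum>\<^sub>e\<^sub>\<in>\<^sub>F \<xi> n e *\<^sub>R e\<close>.  For \<open>v = \<Sum>\<^sub>n t\<^sub>n x\<^sub>n\<close> with \<open>\<bar>t\<^sub>n\<bar> \<le> 1\<close>, weak* summability gives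
  \<open>\<parallel>v\<parallel>\<^sup>2 = \<Sum>\<^sub>n t\<^sub>n (\<xi> n v) \<le> C \<parallel>v\<parallel>\<close>, which is the hypothesis of the little Grothendieck
  inequality.  Its conclusion bounds the Hilbert-Schmidt sum of each partial sum of the series
  for \<open>u\<close>, compressed to finitely many coordinates on both sides, and the bound survives the limit.\<close>

lemma weakly_star_1_nuclear_imp_hilbert_schmidt:
  fixes u :: "'a::hilbert_space \<Rightarrow>\<^sub>L 'b::hilbert_space"
  assumes "weakly_star_1_nuclear u"
  shows "hilbert_schmidt u"
proof -
  obtain \<xi> y where \<xi>: "weakly_star_1_summable \<xi>" and y: "bounded (range y)"
    and u: "\<And>x. (\<lambda>n. blinfun_apply (\<xi> n) x *\<^sub>R y n) sums blinfun_apply u x"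
    using assms by (auto simp: weakly_star_1_nuclear_def)
  obtain C where C: "C \<ge> 0" "\<And>x N. (\<Sum>n<N. \<bar>blinfun_apply (\<xi> n) x\<bar>) \<le> C * norm x"
    using \<xi> by (auto simp: weakly_star_1_summable_iff)
  obtain M where M: "M > 0" "\<And>n. norm (y n) \<le> M"
    using y by (auto simp: bounded_pos)
  obtain B :: "'a set" where B: "orthonormal_basis B" using orthonormal_basis_exists by blast
  then have onB: "orthonormal B" by (auto simp: orthonormal_basis_def orthonormal_def)
  have bound: "(\<Sum>e\<in>F. (norm (blinfun_apply u e))\<^sup>2) \<le> M\<^sup>2 * (48 * C\<^sup>2)"
    if F: "finite F" "F \<subseteq> B" for F
  proof -
    have onF: "orthonormal F" by (rule orthonormal_mono[OF onB F(2)])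
    obtain G where G: "finite G" "orthonormal G" "blinfun_apply u ` F \<subseteq> span G"
      using finite_gram_schmidt[of "blinfun_apply u ` F"] F by blast
    define x where "x n = (\<Sum>e\<in>F. blinfun_apply (\<xi> n) e *\<^sub>R e)" for n
    have xv: "x n \<bullet> v = blinfun_apply (\<xi> n) v" if "v \<in> span F" for n v
    proof -
      have "x n \<bullet> v = (\<Sum>e\<in>F. (v \<bullet> e) * blinfun_apply (\<xi> n) e)"
        unfolding x_def inner_sum_left by (rule sum.cong) (simp_all add: inner_commute)
      also have "\<dots> = blinfun_apply (\<xi> n) (\<Sum>e\<in>F. (v \<bullet> e) *\<^sub>R e)"
        by (simp add: blinfun.sum_right blinfun.scaleR_right)
      finally show ?thesis using orthonormal_expansion[OF F(1) onF that] by simp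
    qed
    have signs: "norm (\<Sum>n<N. t n *\<^sub>R x n) \<le> C" if t: "\<And>n. \<bar>t n\<bar> \<le> 1" for t N
    proof -
      define v where "v = (\<Sum>n<N. t n *\<^sub>R x n)"
      have "v \<in> span F"
        unfolding v_def x_def by (intro span_sum span_scale span_base)
      then have "v \<bullet> v = (\<Sum>n<N. t n * blinfun_apply (\<xi> n) v)"
        using xv by (subst (1) v_def) (simp add: inner_sum_left)
      also have "\<dots> \<le> (\<Sum>n<N. \<bar>blinfun_apply (\<xi> n) v\<bar>)"
      proof (rule sum_mono)
        fix n
        have "t n * blinfun_apply (\<xi> n) v \<le> \<bar>t n\<bar> * \<bar>blinfun_apply (\<xi> n) v\<bar>"
          by (simp add: abs_mult[symmetric])
        also have "\<dots> \<le> 1 * \<bar>blinfun_apply (\<xi> n) v\<bar>" by (intro mult_right_mono t) auto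
        finally show "t n * blinfun_apply (\<xi> n) v \<le> \<bar>blinfun_apply (\<xi> n) v\<bar>" by simp
      qed
      also have "\<dots> \<le> C * norm v" by (rule C(2))
      finally have "norm v * norm v \<le> C * norm v" by (simp add: norm_eq_sqrt_inner)
      then have "norm v \<le> C" using C(1) by (cases "norm v = 0") auto
      then show ?thesis by (simp add: v_def)
    qed
    define w where "w N e = (\<Sum>n<N. blinfun_apply (\<xi> n) e *\<^sub>R y n)" for N e
    have partial: "(\<Sum>e\<in>F. \<Sum>g\<in>G. (w N e \<bullet> g)\<^sup>2) \<le> M\<^sup>2 * (48 * C\<^sup>2)" for N
    proof -
      have b: "(\<Sum>g\<in>G. ((y n \<bullet> g) / M)\<^sup>2) \<le> 1" for n
      proof -
        have "(\<Sum>g\<in>G. (y n \<bullet> g)\<^sup>2) \<le> M\<^sup>2"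
          using orthonormal_bessel[OF G(1,2)] power_mono[OF M(2), of n 2] order_trans by fastforce
        then show ?thesis
          using M(1) by (simp add: power_divide sum_divide_distrib[symmetric])
      qed
      have "(\<Sum>n<N. ((y n \<bullet> g) / M) *\<^sub>R x n) = (\<Sum>e\<in>F. ((w N e \<bullet> g) / M) *\<^sub>R e)" for g
      proof -
        have "(\<Sum>n<N. ((y n \<bullet> g) / M) *\<^sub>R x n)
            = (\<Sum>e\<in>F. \<Sum>n<N. ((y n \<bullet> g) / M * blinfun_apply (\<xi> n) e) *\<^sub>R e)"
          unfolding x_def scaleR_sum_right by (subst sum.swap) simp
        also have "\<dots> = (\<Sum>e\<in>F. ((w N e \<bullet> g) / M) *\<^sub>R e)"
          unfolding w_def scaleR_sum_left[symmetric] inner_sum_left sum_divide_distrib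
          by (simp add: mult.commute)
        finally show ?thesis .
      qed
      then have "(\<Sum>g\<in>G. \<Sum>e\<in>F. ((w N e \<bullet> g) / M)\<^sup>2)
          = (\<Sum>g\<in>G. (norm (\<Sum>n<N. ((y n \<bullet> g) / M) *\<^sub>R x n))\<^sup>2)"
        using norm_orthonormal_sum[OF F(1) onF] by simp
      also have "\<dots> \<le> 48 * C\<^sup>2"
        by (rule little_grothendieck) (use signs G b in auto)
      finally have "(\<Sum>g\<in>G. \<Sum>e\<in>F. (w N e \<bullet> g)\<^sup>2) / M\<^sup>2 \<le> 48 * C\<^sup>2"
        by (simp add: power_divide sum_divide_distrib)
      then show ?thesis
        using M(1) by (subst sum.swap) (simp add: field_simps)
    qed
    have "(\<lambda>N. w N e) \<longlonglongrightarrow> blinfun_apply u e" for e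
      using u[of e] by (simp add: sums_def w_def)
    then have "(\<lambda>N. \<Sum>e\<in>F. \<Sum>g\<in>G. (w N e \<bullet> g)\<^sup>2)
        \<longlonglongrightarrow> (\<Sum>e\<in>F. \<Sum>g\<in>G. (blinfun_apply u e \<bullet> g)\<^sup>2)"
      by (intro tendsto_intros)
    then have "(\<Sum>e\<in>F. \<Sum>g\<in>G. (blinfun_apply u e \<bullet> g)\<^sup>2) \<le> M\<^sup>2 * (48 * C\<^sup>2)"
      by (rule LIMSEQ_le_const2) (use partial in blast)
    moreover have "(norm (blinfun_apply u e))\<^sup>2 = (\<Sum>g\<in>G. (blinfun_apply u e \<bullet> g)\<^sup>2)" if "e \<in> F" for e
      by (rule orthonormal_parseval[OF G(1,2)]) (use G(3) that in blast)
    ultimately show ?thesis by simp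
  qed
  have "(\<lambda>e. (norm (blinfun_apply u e))\<^sup>2) summable_on B"
    by (rule nonneg_bdd_above_summable_on) (auto intro!: bdd_aboveI bound)
  then show ?thesis using B by (auto simp: hilbert_schmidt_def)
qed

text \<open>Only countably many basis vectors satisfy \<open>u e \<noteq> 0\<close>, and these are numbered by an injection.
  The partial sums \<open>T N\<close> of the expansion are bounded uniformly by \<open>K\<close> and agree with \<open>u\<close>
  eventually at each vector of the dense subspace \<open>span B\<close>, so they converge to \<open>u\<close> everywhere.\<close>

lemma hilbert_schmidt_imp_weakly_star_1_nuclear:
  fixes u :: "'a::hilbert_space \<Rightarrow>\<^sub>L 'b::hilbert_space"
  assumes "hilbert_schmidt u"
  shows "weakly_star_1_nuclear u"
proof -
  obtain B where B: "orthonormal_basis B"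
    and su: "(\<lambda>e. (norm (blinfun_apply u e))\<^sup>2) summable_on B"
    using assms by (auto simp: hilbert_schmidt_def)
  have onB: "orthonormal B" and dense: "closure (span B) = UNIV"
    using B by (auto simp: orthonormal_basis_def orthonormal_def)
  define K where "K = sqrt (\<Sum>\<^sub>\<infinity>e\<in>B. (norm (blinfun_apply u e))\<^sup>2)"
  have bound: "(\<Sum>e\<in>F. \<bar>x \<bullet> e\<bar> * norm (blinfun_apply u e)) \<le> K * norm x"
    if F: "finite F" "F \<subseteq> B" for F x
  proof -
    have "(\<Sum>e\<in>F. (norm (blinfun_apply u e))\<^sup>2) \<le> (\<Sum>\<^sub>\<infinity>e\<in>B. (norm (blinfun_apply u e))\<^sup>2)"
      by (rule finite_sum_le_infsum[OF su F]) simp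
    moreover have "(\<Sum>e\<in>F. \<bar>x \<bullet> e\<bar>\<^sup>2) \<le> (norm x)\<^sup>2"
      using orthonormal_bessel[OF F(1) orthonormal_mono[OF onB F(2)]] by simp
    ultimately have "(\<Sum>e\<in>F. \<bar>x \<bullet> e\<bar>\<^sup>2) * (\<Sum>e\<in>F. (norm (blinfun_apply u e))\<^sup>2)
        \<le> (norm x)\<^sup>2 * (\<Sum>\<^sub>\<infinity>e\<in>B. (norm (blinfun_apply u e))\<^sup>2)"
      by (intro mult_mono) (auto intro: sum_nonneg)
    then have "(\<Sum>e\<in>F. \<bar>x \<bullet> e\<bar> * norm (blinfun_apply u e))\<^sup>2
        \<le> (norm x)\<^sup>2 * (\<Sum>\<^sub>\<infinity>e\<in>B. (norm (blinfun_apply u e))\<^sup>2)"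
      using Cauchy_Schwarz_ineq_sum[of "\<lambda>e. \<bar>x \<bullet> e\<bar>" "\<lambda>e. norm (blinfun_apply u e)" F] by linarith
    then have "(\<Sum>e\<in>F. \<bar>x \<bullet> e\<bar> * norm (blinfun_apply u e))
        \<le> sqrt ((norm x)\<^sup>2 * (\<Sum>\<^sub>\<infinity>e\<in>B. (norm (blinfun_apply u e))\<^sup>2))"
      by (rule real_le_rsqrt)
    then show ?thesis by (simp add: K_def real_sqrt_mult mult.commute)
  qed
  have K: "K \<ge> 0" by (simp add: K_def infsum_nonneg)
  define S where "S = {e\<in>B. blinfun_apply u e \<noteq> 0}"
  have "countable S"
    using summable_countable_real[OF su] by (simp add: S_def)
  then obtain i :: "'a \<Rightarrow> nat" where i: "inj_on i S" by (auto simp: countable_def)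
  define s where "s n = the_inv_into S i n" for n
  \<comment> \<open>Numbers outside the range of the injection get the zero functional, since \<open>s n\<close> is arbitrary
    there.\<close>
  define \<xi> where "\<xi> n = (if n \<in> i ` S then
      norm (blinfun_apply u (s n)) *\<^sub>R blinfun_inner_left (s n) else 0)" for n
  define y where "y n = blinfun_apply u (s n) /\<^sub>R norm (blinfun_apply u (s n))" for n
  define S' where "S' N = {e\<in>S. i e < N}" for N
  have S': "finite (S' N)" "S' N \<subseteq> B" for N
  proof -
    have "inj_on i (S' N)" "i ` S' N \<subseteq> {..<N}"
      using i by (auto simp: S'_def intro: inj_on_subset)
    then show "finite (S' N)" using finite_imageD finite_subset finite_lessThan by metis
  qed (auto simp: S'_def S_def)
  have si: "s (i e) = e" if "e \<in> S" for e
    unfolding s_def using the_inv_into_f_f[OF i that] .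
  have reindex: "(\<Sum>n<N. f n) = (\<Sum>e\<in>S' N. f (i e))" if "\<And>n. n \<notin> i ` S \<Longrightarrow> f n = 0"
    for f :: "nat \<Rightarrow> 'c::comm_monoid_add" and N
  proof -
    have "(\<Sum>n<N. f n) = (\<Sum>n\<in>i ` S' N. f n)"
    proof (rule sum.mono_neutral_right)
      show "\<forall>n\<in>{..<N} - i ` S' N. f n = 0"
      proof
        fix n assume "n \<in> {..<N} - i ` S' N"
        then have "n \<notin> i ` S" by (auto simp: S'_def)
        then show "f n = 0" by (rule that)
      qed
    qed (auto simp: S'_def)
    also have "\<dots> = (\<Sum>e\<in>S' N. f (i e))"
      by (subst sum.reindex) (use i in \<open>auto simp: S'_def intro: inj_on_subset\<close>)
    finally show ?thesis .
  qed
  have \<xi>: "blinfun_apply (\<xi> (i e)) x = (x \<bullet> e) * norm (blinfun_apply u e)" if "e \<in> S" for e x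
    using that by (simp add: \<xi>_def si blinfun.scaleR_left)
  have "(\<Sum>n<N. \<bar>blinfun_apply (\<xi> n) x\<bar>) \<le> K * norm x" for N x
  proof -
    have "(\<Sum>n<N. \<bar>blinfun_apply (\<xi> n) x\<bar>) = (\<Sum>e\<in>S' N. \<bar>blinfun_apply (\<xi> (i e)) x\<bar>)"
      by (rule reindex) (simp add: \<xi>_def)
    also have "\<dots> = (\<Sum>e\<in>S' N. \<bar>x \<bullet> e\<bar> * norm (blinfun_apply u e))"
      by (rule sum.cong) (auto simp: \<xi> S'_def abs_mult)
    also have "\<dots> \<le> K * norm x" by (rule bound[OF S'])
    finally show ?thesis .
  qed
  then have "weakly_star_1_summable \<xi>"
    using K by (auto simp: weakly_star_1_summable_iff)
  moreover have "bounded (range y)"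
    by (rule boundedI[of _ 1]) (auto simp: y_def field_simps)
  moreover have "(\<lambda>n. blinfun_apply (\<xi> n) x *\<^sub>R y n) sums blinfun_apply u x" for x
  proof -
    define T where "T N x = (\<Sum>e\<in>S' N. (x \<bullet> e) *\<^sub>R blinfun_apply u e)" for N x
    have part: "(\<Sum>n<N. blinfun_apply (\<xi> n) x *\<^sub>R y n) = T N x" for N
    proof -
      have "(\<Sum>n<N. blinfun_apply (\<xi> n) x *\<^sub>R y n) = (\<Sum>e\<in>S' N. blinfun_apply (\<xi> (i e)) x *\<^sub>R y (i e))"
        by (rule reindex) (simp add: \<xi>_def)
      also have "\<dots> = T N x"
        unfolding T_def
        by (rule sum.cong) (auto simp: \<xi> S'_def S_def y_def si)
      finally show ?thesis .
    qed
    have T_bound: "norm (T N z) \<le> K * norm z" for N z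
    proof -
      have "norm (T N z) \<le> (\<Sum>e\<in>S' N. \<bar>z \<bullet> e\<bar> * norm (blinfun_apply u e))"
        unfolding T_def by (rule order_trans[OF norm_sum]) simp
      then show ?thesis using bound[OF S', of z N] by linarith
    qed
    have T_diff: "T N (z - z') = T N z - T N z'" for N z z'
      by (simp add: T_def inner_diff_left scaleR_diff_left sum_subtractf)
    \<comment> \<open>A vector of the span involves finitely many basis vectors; \<open>T N\<close> is exact once it has passed all
      of them that \<open>u\<close> does not annihilate.\<close>
    have T_span: "\<exists>N0. \<forall>N\<ge>N0. T N z = blinfun_apply u z" if zB: "z \<in> span B" for z
    proof -
      obtain F c where "finite F" "F \<subseteq> B" "z = (\<Sum>f\<in>F. c f *\<^sub>R f)"
        using zB by (auto simp: span_explicit)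
      then have F: "finite F" "F \<subseteq> B" "z \<in> span F" by (auto intro: span_sum span_scale span_base)
      have onF: "orthonormal F" by (rule orthonormal_mono[OF onB F(2)])
      obtain N0 where N0: "i ` (F \<inter> S) \<subseteq> {..<N0}"
        using finite_nat_bounded[of "i ` (F \<inter> S)"] F(1) by (auto simp: lessThan_def)
      have orth: "z \<bullet> e = 0" if "e \<in> B" "e \<notin> F" for e
      proof -
        have "z \<bullet> e = (\<Sum>f\<in>F. (z \<bullet> f) * (f \<bullet> e))"
          by (subst orthonormal_expansion[OF F(1) onF F(3), symmetric]) (simp add: inner_sum_left)
        also have "\<dots> = 0"
        proof (rule sum.neutral, rule ballI)
          fix f assume "f \<in> F"
          then have "f \<in> B" "f \<noteq> e" using F(2) that by auto
          then show "(z \<bullet> f) * (f \<bullet> e) = 0"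
            using orthonormal_inner[OF onB \<open>f \<in> B\<close> \<open>e \<in> B\<close>] by simp
        qed
        finally show ?thesis .
      qed
      have "T N z = blinfun_apply u z" if "N \<ge> N0" for N
      proof -
        have "T N z = (\<Sum>e\<in>F \<inter> S. (z \<bullet> e) *\<^sub>R blinfun_apply u e)"
          unfolding T_def
        proof (rule sum.mono_neutral_right[OF S'(1)])
          show "F \<inter> S \<subseteq> S' N" using N0 that by (fastforce simp: S'_def)
          show "\<forall>e\<in>S' N - F \<inter> S. (z \<bullet> e) *\<^sub>R blinfun_apply u e = 0"
            using orth by (auto simp: S'_def S_def)
        qed
        also have "\<dots> = (\<Sum>e\<in>F. (z \<bullet> e) *\<^sub>R blinfun_apply u e)"
          by (rule sum.mono_neutral_left) (use F in \<open>auto simp: S_def\<close>)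
        also have "\<dots> = blinfun_apply u (\<Sum>e\<in>F. (z \<bullet> e) *\<^sub>R e)"
          by (simp add: blinfun.sum_right blinfun.scaleR_right)
        finally show ?thesis using orthonormal_expansion[OF F(1) onF F(3)] by simp
      qed
      then show ?thesis by blast
    qed
    have "(\<lambda>N. T N x) \<longlonglongrightarrow> blinfun_apply u x"
    proof (rule LIMSEQ_I)
      fix r :: real assume r: "r > 0"
      define d where "d = r / (K + norm u + 1)"
      have den: "K + norm u + 1 > 0" using K norm_ge_zero[of u] by linarith
      then have "d > 0" using r by (simp add: d_def)
      then obtain z where z: "z \<in> span B" "dist z x < d"
        using dense by (metis UNIV_I closure_approachable)
      obtain N0 where N0: "\<And>N. N \<ge> N0 \<Longrightarrow> T N z = blinfun_apply u z" using T_span[OF z(1)] by blast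
      show "\<exists>N0. \<forall>N\<ge>N0. norm (T N x - blinfun_apply u x) < r"
      proof (intro exI allI impI)
        fix N assume "N \<ge> N0"
        then have "T N x - blinfun_apply u x = T N (x - z) + blinfun_apply u (z - x)"
          by (simp add: T_diff N0 blinfun.diff_right)
        then have "norm (T N x - blinfun_apply u x) \<le> norm (T N (x - z)) + norm (blinfun_apply u (z - x))"
          by (simp add: norm_triangle_ineq)
        also have "\<dots> \<le> K * norm (x - z) + norm u * norm (z - x)"
          by (intro add_mono T_bound norm_blinfun)
        also have "\<dots> = (K + norm u) * norm (z - x)"
          by (simp add: norm_minus_commute algebra_simps)
        also have "\<dots> \<le> (K + norm u) * d"
          using z(2) K by (intro mult_left_mono) (auto simp: dist_norm)
        also have "\<dots> < (K + norm u + 1) * d" using \<open>d > 0\<close> by (intro mult_strict_right_mono) auto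
        also have "\<dots> = r" using den by (simp add: d_def)
        finally show "norm (T N x - blinfun_apply u x) < r" .
      qed
    qed
    then show ?thesis by (simp add: sums_def part)
  qed
  ultimately show ?thesis by (auto simp: weakly_star_1_nuclear_def)
qed

theorem proposition3p16:
  fixes u :: "'a::hilbert_space \<Rightarrow>\<^sub>L 'b::hilbert_space"
  shows "weakly_star_1_nuclear u \<longleftrightarrow> hilbert_schmidt u"
  using weakly_star_1_nuclear_imp_hilbert_schmidt hilbert_schmidt_imp_weakly_star_1_nuclear by blast

end
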